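(* If $G$ is a connected bipartite multigraph with $|V(G)|\leq 4$, then $G\in\mathfrak{N}$.
   Context: Multigraphs are finite and may have multiple edges but no loops. A proper edge-coloring of a multigraph assigns colors to edges so that no two edges sharing an endpoint receive the same color. An interval $t$-coloring of a multigraph $G$ is a proper edge-coloring with colors $1,\ldots,t$ such that every color is used and for every vertex $v$ the set of colors of edges incident to $v$ is an interval of integers. $\mathfrak{N}$ denotes the set of multigraphs having an interval $t$-coloring for some positive integer $t$.
   Formalization: The formal theorem also assumes that G has at least one edge; this excludes only the one-vertex graph, which has no interval t-coloring with t positive because no color can be used. *)

theory Defs
  imports Main
begin

text \<open>Parallel edges are distinct elements of \<open>mg_edges\<close> with the same two-element set of endpoints.\<close>

record ('v, 'e) multigraph =
  mg_verts :: "'v set"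
  mg_edges :: "'e set"
  mg_ends :: "'e \<Rightarrow> 'v set"

definition is_multigraph :: "('v, 'e) multigraph \<Rightarrow> bool" where
  "is_multigraph G \<longleftrightarrow>
     finite (mg_verts G) \<and> finite (mg_edges G) \<and>
     (\<forall>e \<in> mg_edges G. mg_ends G e \<subseteq> mg_verts G \<and> card (mg_ends G e) = 2)"

definition mg_incident :: "('v, 'e) multigraph \<Rightarrow> 'v \<Rightarrow> 'e set" where
  "mg_incident G v = {e \<in> mg_edges G. v \<in> mg_ends G e}"

definition mg_adjacent :: "('v, 'e) multigraph \<Rightarrow> 'v \<Rightarrow> 'v \<Rightarrow> bool" where
  "mg_adjacent G u v \<longleftrightarrow> (\<exists>e \<in> mg_edges G. mg_ends G e = {u, v})"

definition mg_connected :: "('v, 'e) multigraph \<Rightarrow> bool" where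
  "mg_connected G \<longleftrightarrow>
     mg_verts G \<noteq> {} \<and>
     (\<forall>u \<in> mg_verts G. \<forall>v \<in> mg_verts G. (mg_adjacent G)\<^sup>*\<^sup>* u v)"

definition mg_bipartite :: "('v, 'e) multigraph \<Rightarrow> bool" where
  "mg_bipartite G \<longleftrightarrow>
     (\<exists>X Y. X \<union> Y = mg_verts G \<and> X \<inter> Y = {} \<and>
        (\<forall>e \<in> mg_edges G. \<exists>x \<in> X. \<exists>y \<in> Y. mg_ends G e = {x, y}))"

definition proper_edge_coloring :: "('v, 'e) multigraph \<Rightarrow> ('e \<Rightarrow> nat) \<Rightarrow> bool" where
  "proper_edge_coloring G \<alpha> \<longleftrightarrow>
     (\<forall>e \<in> mg_edges G. \<forall>f \<in> mg_edges G.
        e \<noteq> f \<longrightarrow> mg_ends G e \<inter> mg_ends G f \<noteq> {} \<longrightarrow> \<alpha> e \<noteq> \<alpha> f)"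

text \<open>The bounds \<open>a\<close>, \<open>b\<close> may satisfy \<open>b < a\<close>: the empty colour set of an isolated vertex counts as an
  interval.\<close>

definition interval_coloring :: "('v, 'e) multigraph \<Rightarrow> nat \<Rightarrow> ('e \<Rightarrow> nat) \<Rightarrow> bool" where
  "interval_coloring G t \<alpha> \<longleftrightarrow>
     proper_edge_coloring G \<alpha> \<and>
     \<alpha> ` mg_edges G = {1..t} \<and>
     (\<forall>v \<in> mg_verts G. \<exists>a b. \<alpha> ` mg_incident G v = {a..b})"

text \<open>Since \<open>t\<close> is positive and all of \<open>1, \<dots>, t\<close> are used, no edgeless multigraph belongs to this set.\<close>

definition interval_colorable :: "('v, 'e) multigraph set" ("\<NN>") where
  "\<NN> = {G. is_multigraph G \<and> (\<exists>t>0. \<exists>\<alpha>. interval_coloring G t \<alpha>)}"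

end

theory Submission
  imports Defs
begin

text \<open>
  If one side of the bipartition is a single vertex, list the edges so that parallel ones are
  consecutive and colour them \<open>1, 2, \<dots>\<close> in that order. Otherwise the sides are \<open>{x1, x2}\<close> and
  \<open>{y1, y2}\<close>; let \<open>a, b, c, d\<close> be the multiplicities of \<open>x1y1, x1y2, x2y1, x2y2\<close>, where \<open>d \<le> a\<close>
  by symmetry. The opposite classes \<open>x1y1\<close> and \<open>x2y2\<close> receive colours ending at \<open>a\<close>, namely
  \<open>{1..a}\<close> and \<open>{a-d+1..a}\<close>, and the other two receive colours starting at \<open>a+1\<close>, namely
  \<open>{a+1..a+b}\<close> and \<open>{a+1..a+c}\<close>. At every vertex a class of the first kind meets one of the second.
\<close>

text \<open>Two distinct edges with a common endpoint are both incident to that vertex, so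
  injectivity of \<open>\<alpha>\<close> on each \<open>mg_incident G v\<close> already gives
  properness. One bijection per vertex thus covers both local conditions.\<close>

lemma interval_colorableI:
  fixes \<alpha> :: "'e \<Rightarrow> nat"
  assumes G: "is_multigraph G"
    and img: "\<alpha> ` mg_edges G = {1..t}" "t > 0"
    and bij: "\<And>v. v \<in> mg_verts G \<Longrightarrow> \<exists>a b. bij_betw \<alpha> (mg_incident G v) {a..b}"
  shows "G \<in> \<NN>"
proof -
  have "proper_edge_coloring G \<alpha>"
    unfolding proper_edge_coloring_def
  proof (intro ballI impI)
    fix e f
    assume e: "e \<in> mg_edges G" and f: "f \<in> mg_edges G" and "e \<noteq> f"
      and "mg_ends G e \<inter> mg_ends G f \<noteq> {}"
    then obtain v where v: "v \<in> mg_ends G e" "v \<in> mg_ends G f" by blast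
    with e G have "v \<in> mg_verts G" by (auto simp: is_multigraph_def)
    then have "inj_on \<alpha> (mg_incident G v)" using bij by (auto simp: bij_betw_def)
    moreover have "e \<in> mg_incident G v" "f \<in> mg_incident G v"
      using e f v by (auto simp: mg_incident_def)
    ultimately show "\<alpha> e \<noteq> \<alpha> f" using \<open>e \<noteq> f\<close> by (auto dest: inj_onD)
  qed
  moreover have "\<exists>a b. \<alpha> ` mg_incident G v = {a..b}" if "v \<in> mg_verts G" for v
    using bij[OF that] by (auto simp: bij_betw_def)
  ultimately show ?thesis
    unfolding interval_colorable_def interval_coloring_def using G img by blast
qed

lemma ex_bij_betw_interval:
  fixes s :: nat
  assumes "finite A"
  shows "\<exists>h. bij_betw h A {Suc s..s + card A}"
  using assms by (intro finite_same_card_bij) auto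

text \<open>Induction on \<open>Y\<close>: the fibre over the new element receives the next free
  numbers after those of all the other fibres. For \<open>y\<close> outside \<open>Y\<close> the
  fibre is empty and matches an interval with \<open>b < a\<close>.\<close>

lemma ex_blockwise_interval_enumeration:
  assumes "finite Y" "finite E" "f ` E \<subseteq> Y"
  shows "\<exists>\<alpha>. bij_betw \<alpha> E {1..card E} \<and>
           (\<forall>y. \<exists>a b. bij_betw \<alpha> {e \<in> E. f e = y} {a..b::nat})"
  using assms
proof (induction Y arbitrary: E rule: finite_induct)
  case empty
  then have "E = {}" by auto
  \<comment> \<open>The interval \<open>{1..0}\<close> is empty, so it serves both for
    \<open>E\<close> itself and for each of its fibres.\<close>
  moreover have "bij_betw \<alpha> {} {1..0}" for \<alpha> :: "'b \<Rightarrow> nat"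
    by (simp add: bij_betw_def)
  ultimately show ?case by (metis (no_types, lifting) card.empty empty_Collect_eq empty_iff)
next
  case (insert z Y)
  define B where "B = {e \<in> E. f e = z}"
  define C where "C = {e \<in> E. f e \<noteq> z}"
  have E: "E = C \<union> B" "C \<inter> B = {}" "finite B" "finite C"
    using insert.prems by (auto simp: B_def C_def)
  then have card: "card E = card C + card B" by (simp add: card_Un_disjoint)
  have "f ` C \<subseteq> Y" using insert.prems by (auto simp: C_def)
  from insert.IH[OF E(4) this] obtain \<beta> where \<beta>: "bij_betw \<beta> C {1..card C}"
    and blocks: "\<And>y. \<exists>a b. bij_betw \<beta> {e \<in> C. f e = y} {a..b}" by blast
  obtain h where h: "bij_betw h B {Suc (card C)..card C + card B}"
    using ex_bij_betw_interval[OF E(3), of "card C"] by blast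
  define \<alpha> where "\<alpha> e = (if e \<in> B then h e else \<beta> e)" for e
  have \<alpha>B: "bij_betw \<alpha> B {Suc (card C)..card C + card B}"
    using h by (simp add: \<alpha>_def cong: bij_betw_cong)
  \<comment> \<open>Stated for all subsets of \<open>C\<close>, because it is used for
    \<open>C\<close> itself and for the fibres over elements other than \<open>z\<close>.\<close>
  have \<alpha>C: "bij_betw \<alpha> S T = bij_betw \<beta> S T" if "S \<subseteq> C" for S T
    using that E(2) by (intro bij_betw_cong) (auto simp: \<alpha>_def)
  have "bij_betw \<alpha> E {1..card E}"
  proof -
    have "bij_betw \<alpha> (C \<union> B) ({1..card C} \<union> {Suc (card C)..card C + card B})"
      using \<beta> \<alpha>B \<alpha>C[of C] by (intro bij_betw_combine) auto
    moreover have "{1..card C} \<union> {Suc (card C)..card C + card B} = {1..card E}"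
      using card by auto
    ultimately show ?thesis using E by simp
  qed
  moreover have "\<exists>a b. bij_betw \<alpha> {e \<in> E. f e = y} {a..b}" for y
  proof (cases "y = z")
    case True
    then show ?thesis using \<alpha>B by (auto simp: B_def)
  next
    case False
    then have "{e \<in> E. f e = y} = {e \<in> C. f e = y}" by (auto simp: C_def)
    then show ?thesis using blocks[of y] \<alpha>C[of "{e \<in> C. f e = y}"] by auto
  qed
  ultimately show ?case by blast
qed

lemma star_interval_colorable:
  assumes G: "is_multigraph G" and ne: "mg_edges G \<noteq> {}"
    and V: "mg_verts G = insert x Y" and x: "x \<notin> Y"
    and ends: "\<And>e. e \<in> mg_edges G \<Longrightarrow> \<exists>y\<in>Y. mg_ends G e = {x, y}"
  shows "G \<in> \<NN>"
proof -
  \<comment> \<open>The fibres to be numbered consecutively are the classes of parallel edges: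
    \<open>f e\<close> is the end of \<open>e\<close> other than the centre \<open>x\<close>. The
    centre sees all the edges, a leaf exactly one fibre.\<close>
  have fin: "finite Y" "finite (mg_edges G)" using G V by (auto simp: is_multigraph_def)
  obtain f where f: "\<And>e. e \<in> mg_edges G \<Longrightarrow> f e \<in> Y \<and> mg_ends G e = {x, f e}"
    using ends by metis
  then have "f ` mg_edges G \<subseteq> Y" by auto
  then obtain \<alpha> where
    \<alpha>: "bij_betw \<alpha> (mg_edges G) {1..card (mg_edges G)}" and
    blocks: "\<And>y. \<exists>a b. bij_betw \<alpha> {e \<in> mg_edges G. f e = y} {a..b}"
    using ex_blockwise_interval_enumeration[OF fin] by blast
  have center: "mg_incident G x = mg_edges G" using f by (auto simp: mg_incident_def)
  have leaf: "mg_incident G y = {e \<in> mg_edges G. f e = y}" if "y \<in> Y" for y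
    using f that x by (auto simp: mg_incident_def)
  show ?thesis
  proof (rule interval_colorableI[OF G])
    show "\<alpha> ` mg_edges G = {1..card (mg_edges G)}" using \<alpha> by (simp add: bij_betw_def)
    show "card (mg_edges G) > 0" using ne fin by (simp add: card_gt_0_iff)
    show "\<exists>a b. bij_betw \<alpha> (mg_incident G v) {a..b}" if "v \<in> mg_verts G" for v
      using that V \<alpha> center leaf blocks by (cases "v = x") (metis, auto)
  qed
qed

lemma two_by_two_interval_colorable:
  assumes G: "is_multigraph G" and ne: "mg_edges G \<noteq> {}"
    and V: "mg_verts G = {x1, x2, y1, y2}" and dist: "distinct [x1, x2, y1, y2]"
    and ends: "\<And>e. e \<in> mg_edges G \<Longrightarrow>
                 mg_ends G e \<in> {{x1, y1}, {x1, y2}, {x2, y1}, {x2, y2}}"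
    and le: "card {e \<in> mg_edges G. mg_ends G e = {x2, y2}}
               \<le> card {e \<in> mg_edges G. mg_ends G e = {x1, y1}}"
  shows "G \<in> \<NN>"
proof -
  define A where "A = {e \<in> mg_edges G. mg_ends G e = {x1, y1}}"
  define B where "B = {e \<in> mg_edges G. mg_ends G e = {x1, y2}}"
  define C where "C = {e \<in> mg_edges G. mg_ends G e = {x2, y1}}"
  define D where "D = {e \<in> mg_edges G. mg_ends G e = {x2, y2}}"
  note defs = A_def B_def C_def D_def
  have "finite (mg_edges G)" using G by (simp add: is_multigraph_def)
  then have fin: "finite A" "finite B" "finite C" "finite D" by (auto simp: defs)
  have E: "mg_edges G = A \<union> B \<union> C \<union> D" using ends by (auto simp: defs)
  have neq: "x1 \<noteq> x2" "x1 \<noteq> y1" "x1 \<noteq> y2" "x2 \<noteq> y1" "x2 \<noteq> y2" "y1 \<noteq> y2"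
    "x2 \<noteq> x1" "y1 \<noteq> x1" "y2 \<noteq> x1" "y1 \<noteq> x2" "y2 \<noteq> x2" "y2 \<noteq> y1"
    using dist by auto
  have disj: "A \<inter> B = {}" "A \<inter> C = {}" "A \<inter> D = {}" "B \<inter> C = {}" "B \<inter> D = {}" "C \<inter> D = {}"
    by (simp_all add: defs disjoint_iff doubleton_eq_iff neq)
  have "(x1 \<in> mg_ends G e) = (e \<in> A \<union> B) \<and> (x2 \<in> mg_ends G e) = (e \<in> D \<union> C) \<and>
      (y1 \<in> mg_ends G e) = (e \<in> A \<union> C) \<and> (y2 \<in> mg_ends G e) = (e \<in> D \<union> B)"
    if "e \<in> mg_edges G" for e
  proof -
    have "mg_ends G e = {x1, y1} \<or> mg_ends G e = {x1, y2} \<or> mg_ends G e = {x2, y1} \<or>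
        mg_ends G e = {x2, y2}"
      using ends[OF that] by simp
    then show ?thesis
      using that by (elim disjE) (simp_all add: defs doubleton_eq_iff neq)
  qed
  \<comment> \<open>Each vertex meets one of the classes \<open>A\<close>, \<open>D\<close> and one
    of \<open>B\<close>, \<open>C\<close>. The class whose colours will end at \<open>a\<close> is
    written first, as in \<open>glue\<close> below.\<close>
  then have inc: "mg_incident G x1 = A \<union> B" "mg_incident G x2 = D \<union> C"
    "mg_incident G y1 = A \<union> C" "mg_incident G y2 = D \<union> B"
    unfolding mg_incident_def E by auto
  define a b c d where "a = card A" and "b = card B" and "c = card C" and "d = card D"
  have da: "d \<le> a" using le by (simp add: a_def d_def A_def D_def)
  obtain hA where hA: "bij_betw hA A {Suc 0..a}"
    using ex_bij_betw_interval[OF fin(1), of 0] by (auto simp: a_def)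
  obtain hB where hB: "bij_betw hB B {Suc a..a + b}"
    using ex_bij_betw_interval[OF fin(2), of a] by (auto simp: b_def)
  obtain hC where hC: "bij_betw hC C {Suc a..a + c}"
    using ex_bij_betw_interval[OF fin(3), of a] by (auto simp: c_def)
  \<comment> \<open>By \<open>da\<close> the subtraction is not truncated, so the block of length
    \<open>d\<close> that starts at \<open>Suc (a - d)\<close> ends exactly at
    \<open>a\<close>.\<close>
  obtain hD where hD: "bij_betw hD D {Suc (a - d)..a}"
    using ex_bij_betw_interval[OF fin(4), of "a - d"] da by (auto simp: d_def)
  define \<alpha> where "\<alpha> e = (if e \<in> A then hA e else if e \<in> B then hB e
                            else if e \<in> C then hC e else hD e)" for e
  have "bij_betw \<alpha> A {Suc 0..a} = bij_betw hA A {Suc 0..a}"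
    using disj by (intro bij_betw_cong) (auto simp: \<alpha>_def)
  with hA have \<alpha>A: "bij_betw \<alpha> A {Suc 0..a}" by simp
  have "bij_betw \<alpha> B {Suc a..a + b} = bij_betw hB B {Suc a..a + b}"
    using disj by (intro bij_betw_cong) (auto simp: \<alpha>_def)
  with hB have \<alpha>B: "bij_betw \<alpha> B {Suc a..a + b}" by simp
  have "bij_betw \<alpha> C {Suc a..a + c} = bij_betw hC C {Suc a..a + c}"
    using disj by (intro bij_betw_cong) (auto simp: \<alpha>_def)
  with hC have \<alpha>C: "bij_betw \<alpha> C {Suc a..a + c}" by simp
  have "bij_betw \<alpha> D {Suc (a - d)..a} = bij_betw hD D {Suc (a - d)..a}"
    using disj by (intro bij_betw_cong) (auto simp: \<alpha>_def)
  with hD have \<alpha>D: "bij_betw \<alpha> D {Suc (a - d)..a}" by simp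
  \<comment> \<open>A block ending at \<open>a\<close> and one starting at \<open>Suc a\<close> join
    without gap or overlap, even if one of them is empty. Here \<open>l\<close> is \<open>0\<close>
    for the class \<open>A\<close> and \<open>a - d\<close> for \<open>D\<close>.\<close>
  have glue: "bij_betw \<alpha> (P \<union> Q) {Suc l..a + n}"
    if "bij_betw \<alpha> P {Suc l..a}" "bij_betw \<alpha> Q {Suc a..a + n}" "l \<le> a" for P Q l n
  proof -
    have "bij_betw \<alpha> (P \<union> Q) ({Suc l..a} \<union> {Suc a..a + n})"
      using that by (intro bij_betw_combine) auto
    moreover have "{Suc l..a} \<union> {Suc a..a + n} = {Suc l..a + n}" using that(3) by auto
    ultimately show ?thesis by simp
  qed
  show ?thesis
  proof (rule interval_colorableI[OF G])
    show img: "\<alpha> ` mg_edges G = {1..a + max b c}"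
    proof -
      have "\<alpha> ` mg_edges G = {Suc 0..a} \<union> {Suc a..a + b} \<union> {Suc a..a + c} \<union> {Suc (a - d)..a}"
        using \<alpha>A \<alpha>B \<alpha>C \<alpha>D by (simp add: E image_Un bij_betw_def)
      \<comment> \<open>The colours of \<open>D\<close> lie among those of \<open>A\<close>, and the
        longer of the two blocks above \<open>a\<close> contains the other.\<close>
      also have "\<dots> = {1..a + max b c}" by auto
      finally show ?thesis .
    qed
    show "a + max b c > 0" using img ne by (cases "a + max b c = 0") auto
    show "\<exists>a b. bij_betw \<alpha> (mg_incident G v) {a..b}" if "v \<in> mg_verts G" for v
      using that V inc glue[OF \<alpha>A \<alpha>B] glue[OF \<alpha>A \<alpha>C] glue[OF \<alpha>D \<alpha>C] glue[OF \<alpha>D \<alpha>B]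
      by (metis diff_le_self empty_iff insert_iff le0)
  qed
qed

theorem theorem14:
  fixes G :: "('v, 'e) multigraph"
  assumes "is_multigraph G"
    and "mg_connected G"
    and "mg_bipartite G"
    and "card (mg_verts G) \<le> 4"
    and "mg_edges G \<noteq> {}"
  shows "G \<in> \<NN>"
proof -
  obtain X Y where XY: "X \<union> Y = mg_verts G" "X \<inter> Y = {}"
    and ends: "\<forall>e\<in>mg_edges G. \<exists>x\<in>X. \<exists>y\<in>Y. mg_ends G e = {x, y}"
    using assms(3) unfolding mg_bipartite_def by blast
  have fin: "finite X" "finite Y"
    using assms(1) by (simp_all add: is_multigraph_def flip: XY(1))
  have sum: "card X + card Y \<le> 4" using assms(4) fin XY by (metis card_Un_disjoint)
  \<comment> \<open>Some edge exists, and it has an end on each side.\<close>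
  have "X \<noteq> {}" "Y \<noteq> {}" using assms(5) ends by blast+
  then have "card X \<noteq> 0" "card Y \<noteq> 0" using fin by auto
  with sum consider "card X = 1" | "card Y = 1" | "card X = 2" "card Y = 2" by linarith
  then show ?thesis
  proof cases
    case 1
    then obtain x where "X = {x}" by (auto simp: card_1_singleton_iff)
    then show ?thesis using XY ends by (intro star_interval_colorable[OF assms(1,5), of x Y]) auto
  next
    case 2
    then obtain y where "Y = {y}" by (auto simp: card_1_singleton_iff)
    then show ?thesis using XY ends
      by (intro star_interval_colorable[OF assms(1,5), of y X]) (auto simp: insert_commute)
  next
    case 3
    obtain x1 x2 where X: "X = {x1, x2}" "x1 \<noteq> x2" using 3 by (auto simp: card_2_iff)
    obtain y1 y2 where Y: "Y = {y1, y2}" "y1 \<noteq> y2" using 3 by (auto simp: card_2_iff)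
    \<comment> \<open>Swapping the names within both sides at once exchanges the classes
      \<open>A\<close> and \<open>D\<close>, and also \<open>B\<close> and \<open>C\<close>. In one
      of the two namings the class of \<open>x2\<close>, \<open>y2\<close> is no larger than that of
      \<open>x1\<close>, \<open>y1\<close>, so every fact is prepared for both.\<close>
    have V: "mg_verts G = {x1, x2, y1, y2}" "mg_verts G = {x2, x1, y2, y1}"
      using XY X Y by auto
    have dist: "distinct [x1, x2, y1, y2]" "distinct [x2, x1, y2, y1]"
      using XY X Y by auto
    have ends': "mg_ends G e \<in> {{x1, y1}, {x1, y2}, {x2, y1}, {x2, y2}}"
      "mg_ends G e \<in> {{x2, y2}, {x2, y1}, {x1, y2}, {x1, y1}}" if "e \<in> mg_edges G" for e
      using bspec[OF ends that] X Y by auto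
    show ?thesis
      using two_by_two_interval_colorable[OF assms(1,5) V(1) dist(1) ends'(1)]
        two_by_two_interval_colorable[OF assms(1,5) V(2) dist(2) ends'(2)]
        linear by blast
  qed
qed

end
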